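(* Let $n=2pq$, where $p<q$ are odd primes. For $i\in\{0,1,\dots,n-1\}$ let $R_i(x)$ denote the remainder of $x^i\Phi_n^T(x)$ modulo $x^n-1$, i.e. the polynomial obtained from $x^i\Phi_n^T(x)$ by reducing all exponents modulo $n$ to $\{0,\dots,n-1\}$. Then: (1) $\deg(R_i(x))>\deg(\Phi_n^T(x))$ for all $i\in\{0,1,\dots,n-1\}$ with $i\neq 0$ and $i\neq \frac{n}{2}-p$. (2) $\deg(\Phi_n^T(x))=\deg(R_{\frac{n}{2}-p}(x))=\frac{n}{2}+\varphi(n)-p=n-2p-q+1$.
   Context: $\varphi$ is Euler's totient function and $\Phi_n(x)$ is the $n$-th cyclotomic polynomial. For $n=2pq$ with $p<q$ odd primes, all coefficients of $\Phi_n(x)$ lie in $\{-1,0,1\}$ (a known fact). Write uniquely $\Phi_n(x)=f_1(x)-f_2(x)$, where $f_1,f_2$ are polynomials all of whose nonzero coefficients equal $1$ and no power of $x$ occurs in both $f_1$ and $f_2$. Define $\Phi_n^T(x)=f_1(x)+x^{n/2}f_2(x)$, a polynomial with coefficients in $\{0,1\}$ and degree at most $n-1$. *)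

theory Defs
  imports
    Complex_Main
    "HOL-Computational_Algebra.Polynomial"
    "HOL-Number_Theory.Totient"
begin

definition cyclotomic :: "nat \<Rightarrow> complex poly" where
  "cyclotomic n = (\<Prod>k\<in>totatives n. [:- cis (2 * pi * real k / real n), 1:])"

definition zero_one_split :: "complex poly \<Rightarrow> complex poly \<Rightarrow> complex poly \<Rightarrow> bool" where
  "zero_one_split P f\<^sub>1 f\<^sub>2 \<longleftrightarrow>
     P = f\<^sub>1 - f\<^sub>2 \<and>
     (\<forall>k. coeff f\<^sub>1 k \<noteq> 0 \<longrightarrow> coeff f\<^sub>1 k = 1) \<and>
     (\<forall>k. coeff f\<^sub>2 k \<noteq> 0 \<longrightarrow> coeff f\<^sub>2 k = 1) \<and>
     (\<forall>k. \<not> (coeff f\<^sub>1 k \<noteq> 0 \<and> coeff f\<^sub>2 k \<noteq> 0))"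

text \<open>
  The split of \<^term>\<open>P\<close> is unique, and it exists exactly when all coefficients of \<^term>\<open>P\<close> lie in
  \<open>{-1, 0, 1}\<close>. So the definite description in \<open>cyclotomic_T\<close> below denotes the intended
  polynomials whenever the cyclotomic polynomial is flat.
\<close>

lemma zero_one_split_coeffs:
  assumes "zero_one_split P f\<^sub>1 f\<^sub>2"
  shows "coeff f\<^sub>1 k = (if coeff P k = 1 then 1 else 0)"
    and "coeff f\<^sub>2 k = (if coeff P k = -1 then 1 else 0)"
    and "coeff P k \<in> {-1, 0, 1}"
proof -
  have P: "coeff P k = coeff f\<^sub>1 k - coeff f\<^sub>2 k"
    using assms by (simp add: zero_one_split_def)
  have "coeff f\<^sub>1 k = 0 \<and> coeff f\<^sub>2 k = 0 \<or> coeff f\<^sub>1 k = 1 \<and> coeff f\<^sub>2 k = 0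
      \<or> coeff f\<^sub>1 k = 0 \<and> coeff f\<^sub>2 k = 1"
    using assms unfolding zero_one_split_def by blast
  then show "coeff f\<^sub>1 k = (if coeff P k = 1 then 1 else 0)"
    and "coeff f\<^sub>2 k = (if coeff P k = -1 then 1 else 0)"
    and "coeff P k \<in> {-1, 0, 1}"
    by (auto simp: P)
qed

lemma zero_one_split_unique:
  assumes "zero_one_split P f\<^sub>1 f\<^sub>2" "zero_one_split P g\<^sub>1 g\<^sub>2"
  shows "f\<^sub>1 = g\<^sub>1 \<and> f\<^sub>2 = g\<^sub>2"
  by (simp add: poly_eq_iff zero_one_split_coeffs(1,2)[OF assms(1)]
      zero_one_split_coeffs(1,2)[OF assms(2)])

lemma zero_one_split_exists_iff:
  "(\<exists>f\<^sub>1 f\<^sub>2. zero_one_split P f\<^sub>1 f\<^sub>2) \<longleftrightarrow> (\<forall>k. coeff P k \<in> {-1, 0, 1})"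
proof
  assume "\<exists>f\<^sub>1 f\<^sub>2. zero_one_split P f\<^sub>1 f\<^sub>2"
  then show "\<forall>k. coeff P k \<in> {-1, 0, 1}"
    using zero_one_split_coeffs(3) by blast
next
  assume flat: "\<forall>k. coeff P k \<in> {-1, 0, 1}"
  define g :: "complex \<Rightarrow> complex poly"
    where "g c = Poly (map (\<lambda>k. if coeff P k = c then 1 else 0) [0..<Suc (degree P)])" for c
  have g: "coeff (g c) k = (if coeff P k = c then 1 else 0)" if "c \<noteq> 0" for c k
  proof (cases "k \<le> degree P")
    case True
    then show ?thesis
      by (simp add: g_def nth_default_def del: upt_Suc)
  next
    case False
    then show ?thesis
      using that by (simp add: g_def nth_default_def coeff_eq_0 del: upt_Suc)
  qed
  have "coeff P k = coeff (g 1 - g (-1)) k" for k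
    using flat[rule_format, of k] by (auto simp: g)
  then have diff: "P = g 1 - g (-1)"
    by (rule poly_eqI)
  have "zero_one_split P (g 1) (g (-1))"
    unfolding zero_one_split_def
  proof (intro conjI)
    show "P = g 1 - g (-1)"
      by (fact diff)
  qed (simp_all add: g)
  then show "\<exists>f\<^sub>1 f\<^sub>2. zero_one_split P f\<^sub>1 f\<^sub>2"
    by blast
qed

definition cyclotomic_T :: "nat \<Rightarrow> complex poly" where
  "cyclotomic_T n =
     (let (f\<^sub>1, f\<^sub>2) = (THE (g\<^sub>1, g\<^sub>2). zero_one_split (cyclotomic n) g\<^sub>1 g\<^sub>2)
      in f\<^sub>1 + monom 1 (n div 2) * f\<^sub>2)"

lemma cyclotomic_T_eq:
  assumes "zero_one_split (cyclotomic n) f\<^sub>1 f\<^sub>2"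
  shows "cyclotomic_T n = f\<^sub>1 + monom 1 (n div 2) * f\<^sub>2"
proof -
  have "(THE (g\<^sub>1, g\<^sub>2). zero_one_split (cyclotomic n) g\<^sub>1 g\<^sub>2) = (f\<^sub>1, f\<^sub>2)"
    by (rule the_equality) (use assms zero_one_split_unique in auto)
  then show ?thesis
    by (simp add: cyclotomic_T_def)
qed

definition shift_rem :: "nat \<Rightarrow> nat \<Rightarrow> complex poly" where
  "shift_rem n i = (monom 1 i * cyclotomic_T n) mod (monom 1 n - 1)"

end

theory Submission
  imports Defs
begin

text \<open>
  Choose \<open>u, v\<close> with \<open>u p + v q = p q + 1\<close>. The Lam-Leung description of \<open>\<Phi>\<^bsub>pq\<^esub>\<close> gives
  \<open>\<Phi>\<^bsub>2pq\<^esub>(x) = A(-x) - B(-x)\<close>, where \<open>A\<close> has the exponents \<open>i p + j q\<close> with \<open>i < u\<close>, \<open>j < v\<close> and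
  \<open>B\<close> the exponents \<open>1 + i p + j q\<close> with \<open>i < q - u\<close>, \<open>j < p - v\<close>. Shifting by \<open>i\<close> rotates the
  exponents of \<open>\<Phi>\<^sup>T\<close> on the cycle of length \<open>n\<close>, and the degree is small exactly when a long
  gap is moved to the top. There are two gaps of length \<open>2p + q - 1\<close>, those between the exponents
  of \<open>f\<^sub>1\<close> and those of \<open>x\<^bsup>n/2\<^esup> f\<^sub>2\<close>. All others are shorter, because already the exponents of
  \<open>A\<close> of a fixed parity have gaps of length at most \<open>p + q\<close>.
\<close>

section \<open>A product identity for the cyclotomic polynomial of index
  \<open>2 * p * q\<close>\<close>

text \<open>The \<open>2 * m\<close>-th roots of unity of odd index are \<open>m\<close> distinct
  roots of \<open>x^m + 1\<close>, and both sides are monic of degree \<open>m\<close>.\<close>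

lemma pow_plus_one_eq_prod:
  assumes "0 < m"
  shows "monom 1 m + 1 =
    (\<Prod>k | k < 2 * m \<and> odd k. [:- cis (2 * pi * real k / real (2 * m)), 1:])"
proof -
  define S where "S = {k. k < 2 * m \<and> odd k}"
  define f where "f k = cis (2 * pi * real k / real (2 * m))" for k
  define P where "P = (\<Prod>k\<in>S. [:- f k, 1:])"
  have S_image: "S = (\<lambda>j. 2 * j + 1) ` {..<m}"
    by (auto simp: S_def elim!: oddE)
  have fin: "finite S"
    by (simp add: S_image)
  have card_S: "card S = m"
    unfolding S_image by (subst card_image) (auto simp: inj_on_def)
  have "inj_on f {..<2 * m}"
    using bij_betw_roots_unity[of "2 * m"] assms by (simp add: f_def[abs_def] bij_betw_def)
  then have inj: "inj_on f S"
    by (rule inj_on_subset) (auto simp: S_def)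
  have deg_P: "degree P = m"
    unfolding P_def by (subst degree_prod_eq_sum_degree) (auto simp: card_S)
  have "lead_coeff P = 1"
    unfolding P_def by (simp add: lead_coeff_prod)
  have root: "f k ^ m = -1" if "k \<in> S" for k
  proof -
    from that obtain j where "k = 2 * j + 1"
      by (auto simp: S_image)
    then have "real m * (2 * pi * real k / real (2 * m)) = pi + 2 * pi * real j"
      using assms by (simp add: field_simps)
    then show ?thesis
      unfolding f_def DeMoivre by (simp flip: cis_mult)
  qed
  have "monom 1 m + 1 = P"
  proof (rule poly_eqI_degree_lead_coeff[where n = m and A = "f ` S"])
    show "coeff (monom 1 m + 1) m = coeff P m"
      using assms deg_P \<open>lead_coeff P = 1\<close> by simp
    show "degree (monom (1::complex) m + 1) \<le> m"
      by (intro degree_add_le) (auto simp: degree_monom_le)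
    show "poly (monom 1 m + 1) z = poly P z" if "z \<in> f ` S" for z
      using that fin root by (auto simp: P_def poly_monom poly_prod)
  qed (simp_all add: card_image inj card_S deg_P)
  then show ?thesis
    by (simp add: P_def S_def f_def)
qed

text \<open>Inclusion-exclusion over the odd residues divisible by \<open>p\<close> or by
  \<open>q\<close>, written without division.\<close>

lemma cyclotomic_two_pq_mult:
  fixes p q :: nat
  assumes "prime p" "prime q" "odd p" "odd q" "p < q"
  shows "cyclotomic (2 * p * q) * (monom 1 p + 1) * (monom 1 q + 1) =
    (monom 1 (p * q) + 1) * (monom 1 1 + 1)"
proof -
  define g where "g k = [:- cis (2 * pi * real k / real (2 * p * q)), 1:]" for k
  define M where "M d = {k. k < 2 * p * q \<and> odd k \<and> d dvd k}" for d
  have pos: "p > 0" "q > 0"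
    using assms by (auto simp: prime_gt_0_nat)
  \<comment> \<open>Dividing the indices in \<open>M d\<close> by \<open>d\<close> leaves the odd
    indices below \<open>2 * e\<close>, that is, the roots of \<open>x^e + 1\<close>.\<close>
  have M_prod: "prod g (M d) = monom 1 e + 1" if "d * e = p * q" for d e
  proof -
    have de: "odd d" "d > 0" "e > 0" "2 * p * q = 2 * d * e"
      using that assms pos by (metis even_mult_iff, auto intro!: gr0I)
    have "M d = (\<lambda>k. d * k) ` {k. k < 2 * e \<and> odd k}"
      using de by (fastforce simp: M_def de(4))
    then have "prod g (M d) = (\<Prod>k | k < 2 * e \<and> odd k. g (d * k))"
      using de by (simp add: prod.reindex inj_on_def)
    also have "\<dots> = (\<Prod>k | k < 2 * e \<and> odd k. [:- cis (2 * pi * real k / real (2 * e)), 1:])"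
      using de by (intro prod.cong refl) (simp add: g_def de(4))
    finally show ?thesis
      using pow_plus_one_eq_prod[OF \<open>e > 0\<close>] by simp
  qed
  have "coprime p q"
    using assms by (simp add: primes_coprime)
  then have inter: "M p \<inter> M q = M (p * q)"
    by (auto simp: M_def divides_mult dest: dvd_mult_left dvd_mult_right)
  have "k \<in> totatives (2 * p * q) \<longleftrightarrow> k \<in> M 1 - (M p \<union> M q)" for k
  proof -
    have "\<And>r. prime r \<Longrightarrow> coprime k r \<longleftrightarrow> \<not> r dvd k"
      by (metis coprime_commute prime_imp_coprime coprime_absorb_left not_prime_unit)
    then have "coprime k (2 * p * q) \<longleftrightarrow> odd k \<and> \<not> p dvd k \<and> \<not> q dvd k"
      using assms by simp
    \<comment> \<open>Totatives may reach the modulus itself, whereas \<open>M\<close> is bounded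
      strictly; oddness settles both this case and \<open>k = 0\<close>.\<close>
    moreover have "k \<noteq> 2 * p * q" if "odd k"
      using that by auto
    ultimately show ?thesis
      by (auto simp: totatives_def M_def intro: gr0I le_neq_implies_less)
  qed
  then have tot: "totatives (2 * p * q) = M 1 - (M p \<union> M q)"
    by blast
  have fin: "finite (M d)" for d
    by (simp add: M_def)
  have "M p \<union> M q \<subseteq> M 1"
    by (auto simp: M_def)
  then have "prod g (M 1) = prod g (totatives (2 * p * q)) * prod g (M p \<union> M q)"
    unfolding tot by (intro prod.subset_diff fin)
  moreover have "prod g (M p \<union> M q) * prod g (M (p * q)) = prod g (M p) * prod g (M q)"
    using prod.union_inter[of "M p" "M q" g] fin inter by simp
  moreover have "cyclotomic (2 * p * q) = prod g (totatives (2 * p * q))"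
    by (simp add: cyclotomic_def g_def)
  ultimately have "cyclotomic (2 * p * q) * (prod g (M p) * prod g (M q)) =
      prod g (M 1) * prod g (M (p * q))"
    by (metis mult.assoc)
  then show ?thesis
    using M_prod[of 1 "p * q"] M_prod[of p q] M_prod[of q p] M_prod[of "p * q" 1]
    by (simp add: mult_ac)
qed

section \<open>Polynomials with coefficients 0 and 1, and their rotation modulo
  \<open>x^n - 1\<close>\<close>

definition indicator_poly :: "nat set \<Rightarrow> complex poly" where
  "indicator_poly E = (\<Sum>k\<in>E. monom 1 k)"

lemma coeff_indicator_poly:
  "finite E \<Longrightarrow> coeff (indicator_poly E) k = of_bool (k \<in> E)"
  by (simp add: indicator_poly_def coeff_sum of_bool_def)

lemma degree_indicator_poly:
  assumes "finite E" "m \<in> E" "\<And>k. k \<in> E \<Longrightarrow> k \<le> m"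
  shows "degree (indicator_poly E) = m"
proof (rule antisym)
  show "degree (indicator_poly E) \<le> m"
    using assms by (intro degree_le) (auto simp: coeff_indicator_poly leD)
  show "m \<le> degree (indicator_poly E)"
    using assms by (intro le_degree) (simp add: coeff_indicator_poly)
qed

lemma indicator_poly_Un_shift:
  assumes "finite A" "finite B" "A \<inter> (+) m ` B = {}"
  shows "indicator_poly (A \<union> (+) m ` B) = indicator_poly A + monom 1 m * indicator_poly B"
proof -
  have "indicator_poly ((+) m ` B) = monom 1 m * indicator_poly B"
    by (simp add: indicator_poly_def sum.reindex mult_monom sum_distrib_left)
  then show ?thesis
    using assms by (simp add: indicator_poly_def sum.union_disjoint)
qed

lemma monom_mod_pow_minus_one:
  assumes "0 < n"
  shows "monom (1::complex) m mod (monom 1 n - 1) = monom 1 (m mod n)"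
proof -
  have deg: "degree (monom (1::complex) n - 1) = n"
    using assms degree_add_eq_left[of "- 1" "monom (1::complex) n"]
    by (simp add: degree_monom_eq)
  have "monom (1::complex) m = (monom 1 n) ^ (m div n) * monom 1 (m mod n)"
    by (simp add: monom_power mult_monom)
  moreover have "(monom (1::complex) n) ^ (m div n) mod (monom 1 n - 1) = 1 mod (monom 1 n - 1)"
    unfolding mod_eq_dvd_iff by (metis power_diff_1_eq dvd_triv_left)
  ultimately have "monom (1::complex) m mod (monom 1 n - 1) =
      monom 1 (m mod n) mod (monom 1 n - 1)"
    by (metis mod_mult_left_eq mult_1)
  also have "\<dots> = monom 1 (m mod n)"
    by (rule mod_poly_less) (simp add: deg degree_monom_eq assms)
  finally show ?thesis .
qed

text \<open>Rotation is injective on exponents below \<open>n\<close>, so no two terms collide and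
  all coefficients stay 0 or 1.\<close>

lemma shift_indicator_poly_mod:
  assumes "0 < n" "E \<subseteq> {..<n}"
  shows "(monom 1 i * indicator_poly E) mod (monom 1 n - 1) =
    indicator_poly ((\<lambda>k. (k + i) mod n) ` E)"
proof -
  have inj: "inj_on (\<lambda>k. (k + i) mod n) E"
  proof (rule inj_onI)
    fix k l assume "k \<in> E" "l \<in> E" "(k + i) mod n = (l + i) mod n"
    then have "[k + i = l + i] (mod n)"
      by (simp add: cong_def)
    then show "k = l"
      using \<open>k \<in> E\<close> \<open>l \<in> E\<close> assms(2)
      by (intro cong_less_modulus_unique_nat[of k l n]) (auto simp: cong_add_rcancel_nat)
  qed
  have "(monom 1 i * indicator_poly E) mod (monom 1 n - 1) =
      (\<Sum>k\<in>E. monom 1 (k + i) mod (monom 1 n - 1)) mod (monom 1 n - 1)"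
    by (simp add: indicator_poly_def sum_distrib_left mult_monom mod_sum_eq add.commute)
  also have "\<dots> = (\<Sum>k\<in>E. monom 1 (k + i)) mod (monom 1 n - 1)"
    by (rule mod_sum_eq)
  also have "\<dots> = (\<Sum>k\<in>E. monom 1 (k + i) mod (monom 1 n - 1))"
    by (induction E rule: infinite_finite_induct) (simp_all add: poly_mod_add_left)
  also have "\<dots> = indicator_poly ((\<lambda>k. (k + i) mod n) ` E)"
    using assms(1) inj by (simp add: indicator_poly_def monom_mod_pow_minus_one sum.reindex)
  finally show ?thesis .
qed

section \<open>Grids of exponents \<open>i * p + j * q\<close> and their gaps within one parity
  class\<close>

locale odd_coprime_pair =
  fixes p q :: nat
  assumes odd_p: "odd p" and odd_q: "odd q" and coprime: "coprime p q"
    and p_gt_1: "1 < p" and p_less_q: "p < q"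
begin

definition grid :: "nat \<Rightarrow> nat \<Rightarrow> nat set" where
  "grid a b = (\<lambda>(i, j). i * p + j * q) ` ({..<a} \<times> {..<b})"

lemma finite_grid: "finite (grid a b)"
  by (simp add: grid_def)

lemma gridI: "i < a \<Longrightarrow> j < b \<Longrightarrow> i * p + j * q \<in> grid a b"
  by (force simp: grid_def)

lemma gridE:
  assumes "k \<in> grid a b"
  obtains i j where "k = i * p + j * q" "i < a" "j < b"
  using assms by (auto simp: grid_def)

text \<open>Modulo \<open>q\<close> the second summand vanishes and \<open>p\<close> is invertible.
  Hence \<open>i\<close> is determined by the sum as soon as it is below \<open>q\<close>.\<close>

lemma cong_first_coordinate:
  assumes "i * p + j * q = i' * p + j' * q"
  shows "[i = i'] (mod q)"
proof -
  have "[i * p + j * q = i' * p + j' * q] (mod q)"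
    using assms by simp
  then have "[i * p = i' * p] (mod q)"
    by (simp add: cong_def)
  then show ?thesis
    using coprime by (simp add: cong_mult_rcancel_nat)
qed

text \<open>For \<open>a \<le> q\<close> distinct index pairs give distinct exponents, so the sum
  factors into two geometric sums. The ring is general because \<open>y\<close> will be the
  polynomial \<open>-x\<close>.\<close>

lemma grid_sum_powers:
  fixes y :: "'a :: comm_ring_1"
  assumes "a \<le> q"
  shows "(\<Sum>k\<in>grid a b. y ^ k) * ((1 - y ^ p) * (1 - y ^ q)) =
    (1 - y ^ (a * p)) * (1 - y ^ (b * q))"
proof -
  have "inj_on (\<lambda>(i, j). i * p + j * q) ({..<a} \<times> {..<b})"
  proof (rule inj_onI, clarsimp)
    fix i j i' j' assume *: "i * p + j * q = i' * p + j' * q" and "i < a" "i' < a"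
    then have "i = i'"
      using cong_less_modulus_unique_nat[OF cong_first_coordinate[OF *]] assms by simp
    with * p_less_q show "i = i' \<and> j = j'"
      by simp
  qed
  then have "(\<Sum>k\<in>grid a b. y ^ k) = (\<Sum>(i, j)\<in>{..<a} \<times> {..<b}. (y ^ p) ^ i * (y ^ q) ^ j)"
    unfolding grid_def
    by (simp add: sum.reindex case_prod_unfold power_add power_mult[symmetric] mult.commute)
  also have "\<dots> = (\<Sum>i<a. (y ^ p) ^ i) * (\<Sum>j<b. (y ^ q) ^ j)"
    by (simp add: sum_product sum.cartesian_product)
  finally show ?thesis
    using one_diff_power_eq[of "y ^ p" a] one_diff_power_eq[of "y ^ q" b]
    by (simp add: power_mult[symmetric] mult_ac)
qed

lemma grid_bound: "k \<in> grid a b \<Longrightarrow> k + p + q \<le> a * p + b * q"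
proof (elim gridE)
  fix i j assume "k = i * p + j * q" "i < a" "j < b"
  then show ?thesis
    using mult_le_mono1[of "i + 1" a p] mult_le_mono1[of "j + 1" b q] by simp
qed

text \<open>The parity of \<open>i * p + j * q\<close> is that of \<open>i + j\<close>. An odd
  element thus avoids the bottom corner and, as \<open>a + b\<close> is even, the top corner too;
  this costs at least \<open>p\<close>, the smaller step, at either end.\<close>

lemma odd_grid_bounds:
  assumes "k \<in> grid a b" "odd k" "even (a + b)"
  shows "p \<le> k" "k + 2 * p + q \<le> a * p + b * q"
proof -
  obtain i j where k: "k = i * p + j * q" "i < a" "j < b"
    using assms(1) by (rule gridE)
  have "odd (i + j)"
    using assms(2) k odd_p odd_q by simp
  then have "1 \<le> i \<or> 1 \<le> j"
    by (cases i) (auto simp: Suc_le_eq odd_pos)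
  then show "p \<le> k"
    using mult_le_mono1[of 1 i p] mult_le_mono1[of 1 j q] p_less_q k(1) by linarith
  have "\<not> (a = i + 1 \<and> b = j + 1)"
    using \<open>odd (i + j)\<close> assms(3) by auto
  then have "i + 2 \<le> a \<or> j + 2 \<le> b"
    using k by linarith
  then show "k + 2 * p + q \<le> a * p + b * q"
    using mult_le_mono1[of "i + 2" a p] mult_le_mono1[of "j + 1" b q]
      mult_le_mono1[of "i + 1" a p] mult_le_mono1[of "j + 2" b q] p_less_q k by auto
qed

text \<open>The moves \<open>(2, 0)\<close>, \<open>(1, 1)\<close> and \<open>(-1, 1)\<close> keep
  the parity and raise the value by \<open>2 * p\<close>, \<open>p + q\<close> and
  \<open>q - p\<close>, all positive and at most \<open>p + q\<close>. None fits only at the last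
  two positions of the row \<open>j = b - 1\<close>, which the hypotheses exclude.\<close>

lemma grid_successor:
  assumes "k \<in> grid a b" "2 \<le> a" "k + p + q \<noteq> a * p + b * q" "k + 2 * p + q \<noteq> a * p + b * q"
  shows "\<exists>l\<in>grid a b. (even l \<longleftrightarrow> even k) \<and> k < l \<and> l \<le> k + p + q"
proof -
  obtain i j where k: "k = i * p + j * q" "i < a" "j < b"
    using assms(1) by (rule gridE)
  consider "i + 2 < a" | "i + 2 \<ge> a" "j + 1 < b" | "i + 2 \<ge> a" "j + 1 = b"
    using k by linarith
  then show ?thesis
  proof cases
    case 1
    then show ?thesis
      using gridI[of "i + 2" a j b] k p_gt_1 p_less_q
      by (intro bexI[of _ "(i + 2) * p + j * q"]) auto
  next
    case 2
    show ?thesis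
    proof (cases i)
      case 0
      then show ?thesis
        using gridI[of 1 a "j + 1" b] 2 k odd_p odd_q p_gt_1 assms(2)
        by (intro bexI[of _ "1 * p + (j + 1) * q"]) auto
    next
      case (Suc i')
      then show ?thesis
        using gridI[of i' a "j + 1" b] 2 k odd_p odd_q p_less_q
        by (intro bexI[of _ "i' * p + (j + 1) * q"]) auto
    qed
  next
    case 3
    then have "a = i + 1 \<or> a = i + 2"
      using k by linarith
    then show ?thesis
      using assms(3,4) 3 k by auto
  qed
qed

text \<open>Apply \<open>grid_successor\<close> to the largest element up to \<open>x\<close> of the
  given parity; by maximality its successor lies beyond \<open>x\<close>.\<close>

lemma grid_gap:
  assumes "k\<^sub>0 \<in> grid a b" "k\<^sub>0 \<le> x" "2 \<le> a"
    and "\<And>k. k \<in> grid a b \<Longrightarrow> even k \<longleftrightarrow> even k\<^sub>0 \<Longrightarrow> k \<le> x \<Longrightarrow>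
      k + p + q \<noteq> a * p + b * q \<and> k + 2 * p + q \<noteq> a * p + b * q"
  obtains l where "l \<in> grid a b" "even l \<longleftrightarrow> even k\<^sub>0" "x < l" "l \<le> x + p + q"
proof -
  define S where "S = {k \<in> grid a b. (even k \<longleftrightarrow> even k\<^sub>0) \<and> k \<le> x}"
  have S: "finite S" "k\<^sub>0 \<in> S"
    using assms finite_grid by (auto simp: S_def)
  define k where "k = Max S"
  have "k \<in> S"
    using S by (auto simp: k_def intro: Max_in)
  then obtain l where l: "l \<in> grid a b" "even l \<longleftrightarrow> even k" "k < l" "l \<le> k + p + q"
    using grid_successor[of k a b] assms by (auto simp: S_def)
  have "l \<notin> S"
    using Max_ge[OF S(1), of l] l(3) by (auto simp: k_def)
  then show ?thesis
    using that[of l] l \<open>k \<in> S\<close> by (auto simp: S_def)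
qed

end


section \<open>The exponents of the positive and the negative terms\<close>

locale cyclotomic_two_pq = odd_coprime_pair +
  fixes u v :: nat
  assumes u: "2 \<le> u" "u < q" and v: "1 \<le> v" "v < p" and uv: "u * p + v * q = p * q + 1"
begin

text \<open>
  Since \<open>p\<close> and \<open>q\<close> are odd, substituting \<open>-x\<close> turns the parity of an exponent into the sign of its
  coefficient.
\<close>

definition A where "A = grid u v"
definition B where "B = Suc ` grid (q - u) (p - v)"

definition pos_exps where "pos_exps = {k \<in> A. even k} \<union> {k \<in> B. odd k}"
definition neg_exps where "neg_exps = {k \<in> A. odd k} \<union> {k \<in> B. even k}"
definition T_exps where "T_exps = pos_exps \<union> (+) (p * q) ` neg_exps"

lemma finite_exps: "finite A" "finite B" "finite pos_exps" "finite neg_exps" "finite T_exps"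
  by (simp_all add: A_def B_def pos_exps_def neg_exps_def T_exps_def finite_grid)

lemma even_uv: "even (u + v)"
proof -
  have "even (u * p + v * q)"
    unfolding uv using odd_p odd_q by simp
  then show ?thesis
    using odd_p odd_q by simp
qed

lemma exps_complement: "u * p + (q - u) * p = p * q" "v * q + (p - v) * q = p * q"
  using u v by (simp_all flip: add_mult_distrib)

lemma uv_complement: "(q - u) * p + (p - v) * q + 1 = p * q"
  using exps_complement uv by linarith

text \<open>Adding \<open>p * q\<close> to a common element and absorbing the successor by
  \<open>uv\<close> gives two representations with first coordinates \<open>i\<close> and
  \<open>u + i'\<close>, both below \<open>q\<close>. They must agree, although
  \<open>i < u\<close>.\<close>

lemma A_B_disjoint: "A \<inter> B = {}"
proof -
  have False if k: "k \<in> A" "k \<in> B" for k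
  proof -
    obtain i j where ij: "k = i * p + j * q" "i < u" "j < v"
      using k(1) unfolding A_def by (rule gridE)
    obtain i' j' where ij': "k = Suc (i' * p + j' * q)" "i' < q - u" "j' < p - v"
      using k(2) unfolding B_def by (auto elim!: gridE)
    have "i * p + (j + p) * q = (u + i') * p + (v + j') * q"
      using ij(1) ij'(1) uv by (simp add: algebra_simps)
    then have "i = u + i'"
      using cong_first_coordinate u ij ij'
      by (intro cong_less_modulus_unique_nat[of i "u + i'" q]) auto
    then show False
      using ij by simp
  qed
  then show ?thesis
    by blast
qed

text \<open>The Lam-Leung formula with denominators cleared: both grid sums have closed forms, and
  the choice of \<open>u\<close> and \<open>v\<close> makes the mixed terms cancel.\<close>

lemma signed_sum_identity:
  fixes y :: "'a :: comm_ring_1"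
  shows "((\<Sum>k\<in>A. y ^ k) - (\<Sum>k\<in>B. y ^ k)) * ((1 - y ^ p) * (1 - y ^ q)) =
    (1 - y ^ (p * q)) * (1 - y)"
proof -
  define a b c d where "a = y ^ (u * p)" and "b = y ^ (v * q)"
    and "c = y ^ ((q - u) * p)" and "d = y ^ ((p - v) * q)"
  define z where "z = y ^ (p * q)"
  have ab: "a * b = z * y"
    unfolding a_def b_def z_def power_add[symmetric] uv by (simp add: mult.commute)
  \<comment> \<open>The 1 in \<open>uv\<close> is exactly the shift by one in the definition of
    \<open>B\<close>, and reappears as the factor \<open>y\<close>.\<close>
  have "Suc ((q - u) * p) = v * q" "Suc ((p - v) * q) = u * p"
    using exps_complement uv by linarith+
  then have yc: "y * c = b" and yd: "y * d = a"
    unfolding a_def b_def c_def d_def by (metis power_Suc)+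
  have bd: "b * d = z"
    unfolding b_def d_def z_def power_add[symmetric] exps_complement ..
  have "(1 - a) * (1 - b) - y * ((1 - c) * (1 - d)) =
      1 - a - b + a * b - y + y * c + y * d - y * c * d"
    by (simp add: algebra_simps)
  also have "\<dots> = (1 - z) * (1 - y)"
    unfolding ab yc yd bd by (simp add: algebra_simps)
  finally have identity:
    "(1 - a) * (1 - b) - y * ((1 - c) * (1 - d)) = (1 - z) * (1 - y)" .
  have "(\<Sum>k\<in>B. y ^ k) = y * (\<Sum>k\<in>grid (q - u) (p - v). y ^ k)"
    by (simp add: B_def sum.reindex sum_distrib_left)
  then show ?thesis
    using grid_sum_powers[of u y v] grid_sum_powers[of "q - u" y "p - v"] u identity
    unfolding A_def a_def b_def c_def d_def z_def
    by (simp add: left_diff_distrib mult.assoc)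
qed

text \<open>Since \<open>p * q + 1 - p - q = (p - 1) * (q - 1)\<close>, this bounds the exponents by
  \<open>\<phi>(n)\<close>. Additive forms avoid truncated subtraction.\<close>

lemma pos_exps_bound:
  assumes "k \<in> pos_exps"
  shows "k + p + q \<le> p * q + 1"
  using assms grid_bound uv uv_complement unfolding pos_exps_def A_def B_def by fastforce

text \<open>Elements from \<open>A\<close> are odd, and those from \<open>B\<close> are successors
  of odd grid elements, so \<open>odd_grid_bounds\<close> applies to both grids.\<close>

lemma neg_exps_bounds:
  assumes "k \<in> neg_exps"
  shows "p \<le> k" "k + 2 * p + q \<le> p * q + 1"
proof -
  have "p \<le> k \<and> k + 2 * p + q \<le> p * q + 1"
  proof (cases "k \<in> A")
    case True
    then have "odd k"
      using assms A_B_disjoint by (auto simp: neg_exps_def)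
    then show ?thesis
      using odd_grid_bounds[of k u v] True even_uv uv by (simp add: A_def)
  next
    case False
    then obtain l where l: "k = Suc l" "l \<in> grid (q - u) (p - v)" "odd l"
      using assms by (auto simp: neg_exps_def B_def)
    have "even (q - u + (p - v))"
      using even_uv odd_p odd_q u v by auto
    then show ?thesis
      using odd_grid_bounds[of l "q - u" "p - v"] l uv_complement by simp
  qed
  then show "p \<le> k" "k + 2 * p + q \<le> p * q + 1"
    by auto
qed

lemma zero_in_pos_exps: "0 \<in> pos_exps"
  using gridI[of 0 u 0 v] u v by (simp add: pos_exps_def A_def)

lemma p_in_neg_exps: "p \<in> neg_exps"
  using gridI[of 1 u 0 v] u v odd_p by (simp add: neg_exps_def A_def)

lemma max_pos_exps:
  obtains m where "m \<in> pos_exps" "m + p + q = p * q + 1"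
proof
  have "(u - 1) * p + p = u * p" "(v - 1) * q + q = v * q"
    using u v add_mult_distrib[of "u - 1" 1 p] add_mult_distrib[of "v - 1" 1 q] by simp_all
  then show "((u - 1) * p + (v - 1) * q) + p + q = p * q + 1"
    using uv by linarith
  have "even ((u - 1) * p + (v - 1) * q)"
    using even_uv odd_p odd_q u v by auto
  then show "(u - 1) * p + (v - 1) * q \<in> pos_exps"
    using gridI[of "u - 1" u "v - 1" v] u v by (simp add: pos_exps_def A_def)
qed

text \<open>The witness has coordinates \<open>(u - 2, v - 1)\<close>, one step \<open>p\<close>
  below the top corner, whose parity is even.\<close>

lemma max_neg_exps:
  obtains m where "m \<in> neg_exps" "m + 2 * p + q = p * q + 1"
proof
  have "u - 2 + 2 = u" "v - 1 + 1 = v"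
    using u v by simp_all
  then have "(u - 2) * p + 2 * p = u * p" "(v - 1) * q + 1 * q = v * q"
    by (metis add_mult_distrib)+
  then show "((u - 2) * p + (v - 1) * q) + 2 * p + q = p * q + 1"
    using uv by linarith
  have "odd ((u - 2) * p + (v - 1) * q)"
    using even_uv odd_p odd_q u v by auto
  then show "(u - 2) * p + (v - 1) * q \<in> neg_exps"
    using gridI[of "u - 2" u "v - 1" v] u v by (simp add: neg_exps_def A_def)
qed

text \<open>The even elements of \<open>A\<close> suffice. Of the two positions without a successor,
  the top corner lies beyond \<open>x\<close> and the other one is odd.\<close>

lemma pos_exps_gap:
  assumes "x + p + q < p * q + 1"
  obtains l where "l \<in> pos_exps" "x < l" "l \<le> x + p + q"
proof -
  have zero: "0 \<in> grid u v"
    using gridI[of 0 u 0 v] u v by simp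
  have "k + p + q \<noteq> u * p + v * q \<and> k + 2 * p + q \<noteq> u * p + v * q"
    if "even k \<longleftrightarrow> even (0 :: nat)" "k \<le> x" for k
  proof
    show "k + p + q \<noteq> u * p + v * q"
      using that assms uv by linarith
    have "odd (k + 2 * p + q)" "even (u * p + v * q)"
      using that odd_p odd_q unfolding uv by auto
    then show "k + 2 * p + q \<noteq> u * p + v * q"
      by metis
  qed
  then obtain l where "l \<in> grid u v" "even l \<longleftrightarrow> even (0 :: nat)" "x < l" "l \<le> x + p + q"
    using grid_gap[OF zero _ u(1), of x] by blast
  then show ?thesis
    using that[of l] by (simp add: pos_exps_def A_def)
qed

text \<open>The odd elements of \<open>A\<close> suffice, starting from \<open>p\<close>; both
  positions without a successor lie beyond \<open>x\<close>.\<close>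

lemma neg_exps_gap:
  assumes "p \<le> x" "x + 2 * p + q < p * q + 1"
  obtains l where "l \<in> neg_exps" "x < l" "l \<le> x + p + q"
proof -
  have "p \<in> grid u v"
    using gridI[of 1 u 0 v] u v by simp
  then show ?thesis
    using that u assms odd_p uv grid_gap[of p u v x] unfolding neg_exps_def A_def by auto
qed

lemma pos_neg_exps_disjoint: "pos_exps \<inter> neg_exps = {}"
  using A_B_disjoint by (auto simp: pos_exps_def neg_exps_def)

text \<open>At \<open>y = -x\<close> the signed sum satisfies the same product identity as the
  cyclotomic polynomial, and the common factors are nonzero.\<close>

lemma cyclotomic_eq:
  assumes "prime p" "prime q"
  shows "cyclotomic (2 * p * q) = indicator_poly pos_exps - indicator_poly neg_exps"
proof -
  define y :: "complex poly" where "y = monom (- 1) 1"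
  have y_power: "y ^ k = monom ((- 1) ^ k) k" for k
    by (simp add: y_def monom_power)
  define F where "F = (\<Sum>k\<in>A. y ^ k) - (\<Sum>k\<in>B. y ^ k)"
  have one_minus: "1 - y ^ k = monom 1 k + 1" if "odd k" for k
    using that by (simp add: y_power minus_monom[symmetric])
  have "F * ((1 - y ^ p) * (1 - y ^ q)) = (1 - y ^ (p * q)) * (1 - y ^ 1)"
    using signed_sum_identity[of y] by (simp add: F_def)
  then have "F * ((monom 1 p + 1) * (monom 1 q + 1)) = (monom 1 (p * q) + 1) * (monom 1 1 + 1)"
    using odd_p odd_q unfolding one_minus[OF odd_p] one_minus[OF odd_q]
    by (subst (asm) (1 2) one_minus) simp_all
  also have "\<dots> = cyclotomic (2 * p * q) * ((monom 1 p + 1) * (monom 1 q + 1))"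
    using cyclotomic_two_pq_mult[OF assms odd_p odd_q p_less_q] by (simp add: mult.assoc)
  finally have "F * ((monom 1 p + 1) * (monom 1 q + 1)) =
      cyclotomic (2 * p * q) * ((monom 1 p + 1) * (monom 1 q + 1))" .
  moreover have "monom (1 :: complex) k + 1 \<noteq> 0" if "k \<noteq> 0" for k
  proof
    assume "monom (1 :: complex) k + 1 = 0"
    then have "coeff (monom (1 :: complex) k + 1) k = 0"
      by simp
    with that show False
      by simp
  qed
  ultimately have "F = cyclotomic (2 * p * q)"
    using p_gt_1 p_less_q by simp
  moreover have "F = indicator_poly pos_exps - indicator_poly neg_exps"
  proof (rule poly_eqI)
    fix k
    have "coeff F k = (if k \<in> A then (- 1) ^ k else 0) - (if k \<in> B then (- 1) ^ k else 0)"
      by (simp add: F_def y_power coeff_sum finite_exps)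
    then show "coeff F k = coeff (indicator_poly pos_exps - indicator_poly neg_exps) k"
      using A_B_disjoint
      by (cases "even k") (auto simp: coeff_indicator_poly finite_exps pos_exps_def neg_exps_def)
  qed
  ultimately show ?thesis
    by simp
qed

lemma cyclotomic_T_eq_indicator:
  assumes "prime p" "prime q"
  shows "cyclotomic_T (2 * p * q) = indicator_poly T_exps"
proof -
  have "zero_one_split (cyclotomic (2 * p * q)) (indicator_poly pos_exps) (indicator_poly neg_exps)"
    using pos_neg_exps_disjoint
    by (auto simp: zero_one_split_def cyclotomic_eq[OF assms] coeff_indicator_poly finite_exps)
  \<comment> \<open>Every positive exponent is below \<open>p * q\<close>.\<close>
  moreover have "pos_exps \<inter> (+) (p * q) ` neg_exps = {}"
    using pos_exps_bound p_gt_1 by fastforce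
  ultimately show ?thesis
    by (simp add: cyclotomic_T_eq T_exps_def indicator_poly_Un_shift finite_exps)
qed

section \<open>Degrees of \<open>\<Phi>^T\<close> and of its rotations\<close>

lemma T_exps_bound:
  assumes "k \<in> T_exps"
  shows "k + 2 * p + q \<le> 2 * p * q + 1"
proof -
  have "2 * p \<le> q * p"
    using p_gt_1 p_less_q by (intro mult_le_mono1) simp
  then have "p \<le> p * q"
    using mult.commute[of p q] by linarith
  consider "k \<in> pos_exps" | l where "l \<in> neg_exps" "k = p * q + l"
    using assms by (auto simp: T_exps_def)
  then show ?thesis
    by cases (use pos_exps_bound[of k] neg_exps_bounds \<open>p \<le> p * q\<close> in \<open>fastforce+\<close>)
qed

lemma T_exps_subset: "T_exps \<subseteq> {..<2 * p * q}"
  using T_exps_bound p_gt_1 by fastforce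

lemma shift_rem_eq_indicator:
  assumes "prime p" "prime q"
  shows "shift_rem (2 * p * q) i = indicator_poly ((\<lambda>k. (k + i) mod (2 * p * q)) ` T_exps)"
  unfolding shift_rem_def cyclotomic_T_eq_indicator[OF assms]
  using p_gt_1 p_less_q by (intro shift_indicator_poly_mod T_exps_subset) simp

lemma degree_cyclotomic_T:
  assumes "prime p" "prime q"
  shows "degree (cyclotomic_T (2 * p * q)) + 2 * p + q = 2 * p * q + 1"
proof -
  obtain m where m: "m \<in> neg_exps" "m + 2 * p + q = p * q + 1"
    by (rule max_neg_exps)
  have "degree (cyclotomic_T (2 * p * q)) = p * q + m"
    unfolding cyclotomic_T_eq_indicator[OF assms]
  proof (rule degree_indicator_poly)
    show "p * q + m \<in> T_exps"
      using m by (auto simp: T_exps_def)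
    show "k \<le> p * q + m" if "k \<in> T_exps" for k
      using T_exps_bound[OF that] m by simp
  qed (rule finite_exps)
  then show ?thesis
    using m by simp
qed

text \<open>This rotation sends \<open>p * q + l\<close> to \<open>2 * p * q + (l - p)\<close>, so
  all negative exponents wrap round to small values. The top is then the largest positive exponent,
  shifted.\<close>

lemma degree_exceptional_shift:
  assumes "prime p" "prime q"
  shows "degree (shift_rem (2 * p * q) (p * q - p)) + 2 * p + q = 2 * p * q + 1"
proof -
  have "p * 1 \<le> p * q"
    using p_less_q by (intro mult_le_mono2) simp
  then have p_le: "p \<le> p * q"
    by simp
  obtain m where m: "m \<in> pos_exps" "m + p + q = p * q + 1"
    by (rule max_pos_exps)
  let ?E = "(\<lambda>k. (k + (p * q - p)) mod (2 * p * q)) ` T_exps"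
  have "degree (shift_rem (2 * p * q) (p * q - p)) = m + (p * q - p)"
    unfolding shift_rem_eq_indicator[OF assms]
  proof (rule degree_indicator_poly)
    have "m + (p * q - p) < 2 * p * q"
      using m p_le p_gt_1 by linarith
    then show "m + (p * q - p) \<in> ?E"
      using m by (force simp: T_exps_def)
  next
    fix e assume "e \<in> ?E"
    then obtain k where k: "k \<in> T_exps" "e = (k + (p * q - p)) mod (2 * p * q)"
      by blast
    consider "k \<in> pos_exps" | l where "l \<in> neg_exps" "k = p * q + l"
      using k by (auto simp: T_exps_def)
    then show "e \<le> m + (p * q - p)"
    proof cases
      case 1
      then have "k \<le> m"
        using pos_exps_bound[of k] m by simp
      then show ?thesis
        unfolding k(2) by (meson mod_less_eq_dividend le_trans add_le_mono1)
    next
      case 2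
      then have l: "p \<le> l" "l + 2 * p + q \<le> p * q + 1"
        using neg_exps_bounds by auto
      then have "k + (p * q - p) = (l - p) + 2 * p * q"
        using 2 p_le by simp
      then have "e = (l - p) mod (2 * p * q)"
        unfolding k(2) by (metis mod_add_self2)
      then have "e \<le> l - p"
        by simp
      then show ?thesis
        using l m by linarith
    qed
  qed (simp add: finite_exps)
  then show ?thesis
    using m p_le by linarith
qed

lemma degree_shift:
  assumes "prime p" "prime q" and i: "0 < i" "i < 2 * p * q" "i \<noteq> p * q - p"
  shows "degree (cyclotomic_T (2 * p * q)) < degree (shift_rem (2 * p * q) i)"
proof -
  define n where "n = 2 * p * q"
  have "p * 1 \<le> p * q"
    using p_less_q by (intro mult_le_mono2) simp
  then have p_le: "p \<le> p * q"
    by simp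
  \<comment> \<open>It suffices to find an exponent that does not wrap round and lands above the
    degree \<open>n + 1 - 2 * p - q\<close>.\<close>
  have "\<exists>k\<in>T_exps. k + i < n \<and> n + 1 < k + i + 2 * p + q"
  proof (cases "n + 1 < i + 2 * p + q")
    case True
    have "0 \<in> T_exps"
      using zero_in_pos_exps by (simp add: T_exps_def)
    with True i show ?thesis
      by (intro bexI[of _ 0]) (auto simp: n_def)
  next
    case False
    \<comment> \<open>This is the degree of \<open>\<Phi>^T\<close> minus \<open>i\<close>; an
      exponent strictly between \<open>x\<close> and \<open>x + 2 * p + q - 1\<close> is
      wanted.\<close>
    define x where "x = n + 1 - (i + 2 * p + q)"
    have x: "x + i + 2 * p + q = n + 1"
      using False by (simp add: x_def)
    \<comment> \<open>The missing equality \<open>x + p + q = p * q + 1\<close> would mean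
      \<open>i = p * q - p\<close>: the gap after the positive exponents.\<close>
    consider "x + p + q < p * q + 1" | "p * q + 1 < x + p + q" "x < p * q + p"
      | "p * q + p \<le> x"
      using x i p_le unfolding n_def by linarith
    then show ?thesis
    proof cases
      case 1
      then obtain l where "l \<in> pos_exps" "x < l" "l \<le> x + p + q"
        by (rule pos_exps_gap)
      then show ?thesis
        using x p_gt_1 by (intro bexI[of _ l]) (auto simp: T_exps_def)
    next
      case 2
      \<comment> \<open>Here \<open>x\<close> lies in the gap between both kinds of exponents, and
        the smallest shifted negative exponent is close enough.\<close>
      then show ?thesis
        using x p_in_neg_exps by (intro bexI[of _ "p * q + p"]) (auto simp: T_exps_def n_def)
    next
      case 3
      define z where "z = x - p * q"
      have z: "x = p * q + z" "p \<le> z"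
        using 3 by (simp_all add: z_def)
      \<comment> \<open>Strictness is \<open>i > 0\<close>; equality would put \<open>x\<close> at
        the largest exponent of all.\<close>
      have "z + 2 * p + q < p * q + 1"
        using x z i unfolding n_def by linarith
      with z(2) obtain l where "l \<in> neg_exps" "z < l" "l \<le> z + p + q"
        by (rule neg_exps_gap)
      then show ?thesis
        using x z p_gt_1 by (intro bexI[of _ "p * q + l"]) (auto simp: T_exps_def)
    qed
  qed
  then obtain k where k: "k \<in> T_exps" "k + i < n" "n + 1 < k + i + 2 * p + q"
    by blast
  then have "k + i \<in> (\<lambda>k. (k + i) mod n) ` T_exps"
    by force
  then have "k + i \<le> degree (shift_rem n i)"
    unfolding n_def shift_rem_eq_indicator[OF assms(1,2)]
    by (intro le_degree) (auto simp: coeff_indicator_poly finite_exps)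
  then show ?thesis
    using k degree_cyclotomic_T[OF assms(1,2)] unfolding n_def by linarith
qed

end

section \<open>Existence of \<open>u\<close> and \<open>v\<close>, and the final assembly\<close>

text \<open>Take \<open>u\<close> as the inverse of \<open>p\<close> modulo \<open>q\<close>, write
  \<open>u * p = w * q + 1\<close> and put \<open>v = p - w\<close>. From \<open>1 < p\<close>
  follows \<open>w \<ge> 1\<close>, so \<open>u * p > q > p\<close> and
  \<open>u \<ge> 2\<close>.\<close>

lemma ex_bezout_coefficients:
  fixes p q :: nat
  assumes "coprime p q" "1 < p" "p < q"
  obtains u v where "2 \<le> u" "u < q" "1 \<le> v" "v < p" "u * p + v * q = p * q + 1"
proof -
  obtain u where u: "u < q" "[u * p = 1] (mod q)"
  proof -
    obtain x where "[p * x = Suc 0] (mod q)"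
      using cong_solve_coprime_nat[OF assms(1)] by blast
    then have "[(x mod q) * p = 1] (mod q)"
      by (simp add: cong_def mod_mult_left_eq mod_mult_right_eq mult.commute)
    then show ?thesis
      using that[of "x mod q"] assms by simp
  qed
  then have "u * p mod q = 1"
    using assms by (simp add: cong_def)
  then obtain w where w: "u * p = w * q + 1"
    by (metis div_mult_mod_eq)
  have "w * q < p * q"
    using w mult_less_mono1[OF u(1), of p] assms unfolding mult.commute[of q p] by linarith
  then have "w < p"
    by simp
  have "w \<noteq> 0"
  proof
    assume "w = 0"
    with w have "u * p = 1"
      by simp
    with \<open>1 < p\<close> show False
      by simp
  qed
  then have "q \<le> w * q"
    by simp
  then have "\<not> u \<le> 1"
    using w mult_le_mono1[of u 1 p] \<open>p < q\<close> by linarith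
  then have "2 \<le> u"
    by simp
  have "(p - w) * q + w * q = p * q"
    using \<open>w < p\<close> by (simp flip: add_mult_distrib)
  then show ?thesis
    using that[of u "p - w"] u(1) w \<open>w < p\<close> \<open>w \<noteq> 0\<close> \<open>2 \<le> u\<close> by simp
qed

theorem theorem2p3:
  fixes p q n :: nat
  assumes "prime p" and "prime q" and "odd p" and "odd q" and "p < q"
    and "n = 2 * p * q"
  shows "(\<forall>i\<in>{0..<n}. i \<noteq> 0 \<and> i \<noteq> n div 2 - p \<longrightarrow>
            degree (shift_rem n i) > degree (cyclotomic_T n)) \<and>
         (degree (cyclotomic_T n) = degree (shift_rem n (n div 2 - p)) \<and>
          degree (shift_rem n (n div 2 - p)) = n div 2 + totient n - p \<and>
          n div 2 + totient n - p = n - 2 * p - q + 1)"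
proof -
  have coprime: "coprime p q"
    using assms by (simp add: primes_coprime)
  have "1 < p"
    using \<open>prime p\<close> by (rule prime_gt_1_nat)
  obtain u v where "2 \<le> u" "u < q" "1 \<le> v" "v < p" "u * p + v * q = p * q + 1"
    using coprime \<open>1 < p\<close> \<open>p < q\<close> by (rule ex_bezout_coefficients)
  then interpret cyclotomic_two_pq p q u v
    using assms coprime \<open>1 < p\<close> by unfold_locales auto
  have half: "n div 2 = p * q"
    using assms by simp
  have "totient n = (p - 1) * (q - 1)"
    using assms coprime by (simp add: totient_mult_coprime totient_prime mult.assoc)
  moreover have "(p - 1) * (q - 1) + p + q = p * q + 1"
    using \<open>1 < p\<close> \<open>p < q\<close> by (cases p; cases q) auto
  ultimately have tot: "totient n + p + q = p * q + 1"
    by simp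
  have T: "degree (cyclotomic_T n) + 2 * p + q = n + 1"
    and R: "degree (shift_rem n (p * q - p)) + 2 * p + q = n + 1"
    using degree_cyclotomic_T degree_exceptional_shift assms by simp_all
  \<comment> \<open>The resulting bound \<open>2 * p + q \<le> n\<close> makes the subtraction in
    \<open>n - 2 * p - q + 1\<close> exact.\<close>
  have "2 * q \<le> p * q"
    using \<open>1 < p\<close> by (intro mult_le_mono1) simp
  then have "2 * p + q \<le> n"
    using \<open>p < q\<close> assms by linarith
  then show ?thesis
    using degree_shift assms T R tot unfolding half by auto
qed

end
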